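(* Let $\alpha$ and $\beta$ be complex numbers such that $\alpha^n + \beta^n \in \mathbb{Z}$ for every integer $n > 0$. Then there exist integers $p$ and $q$ such that $\alpha$ and $\beta$ are the roots (with multiplicity) of the quadratic equation $z^2 - pz - q = 0$; that is, $z^2 - pz - q = (z-\alpha)(z-\beta)$. *)

theory Defs
  imports Complex_Main
begin

end

theory Submission
  imports Defs
begin

text \<open>Write \<open>s\<^sub>n = \<alpha>\<^sup>n + \<beta>\<^sup>n\<close>. Then \<open>2\<alpha>\<beta> = s\<^sub>1\<^sup>2 - s\<^sub>2\<close> is an integer \<open>m\<close>, and
  \<open>m\<^sup>2 = 2 (s\<^sub>2\<^sup>2 - s\<^sub>4)\<close> is even. Hence \<open>m\<close> is even and \<open>\<alpha>\<beta>\<close> is an integer.\<close>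

theorem mainTheorem2:
  fixes \<alpha> \<beta> :: complex
  assumes "\<And>n::nat. n > 0 \<Longrightarrow> \<alpha> ^ n + \<beta> ^ n \<in> \<int>"
  shows "\<exists>p q :: int. \<forall>z::complex. z\<^sup>2 - of_int p * z - of_int q = (z - \<alpha>) * (z - \<beta>)"
proof -
  obtain a where a: "\<alpha> + \<beta> = of_int a"
    using assms[of 1] by (auto elim: Ints_cases)
  obtain b where b: "\<alpha>\<^sup>2 + \<beta>\<^sup>2 = of_int b"
    using assms[of 2] by (auto elim: Ints_cases)
  obtain c where c: "\<alpha> ^ 4 + \<beta> ^ 4 = of_int c"
    using assms[of 4] by (auto elim: Ints_cases)
  define m where "m = a\<^sup>2 - b"
  have m: "of_int m = 2 * (\<alpha> * \<beta>)"
    by (simp add: m_def flip: a b) algebra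
  \<comment> \<open>Both sides equal \<open>4 * \<alpha>\<^sup>2 * \<beta>\<^sup>2\<close>. The
    identity is checked in the complex numbers, where \<alpha> and \<beta> live; injectivity of
    \<open>of_int\<close> then carries it to the integers, where parity makes sense.\<close>
  have "(of_int (m\<^sup>2) :: complex) = of_int (2 * (b\<^sup>2 - c))"
    by (simp add: m flip: b c) algebra
  then have "m\<^sup>2 = 2 * (b\<^sup>2 - c)"
    by (simp only: of_int_eq_iff)
  then have "even (m\<^sup>2)"
    by simp
  then have "even m"
    by simp
  then obtain k where "m = 2 * k" ..
  with m have k: "of_int k = \<alpha> * \<beta>"
    by simp
  \<comment> \<open>Vieta's formulas give the witnesses \<open>a\<close> for \<open>p\<close> and
    \<open>- k\<close> for \<open>q\<close>: the constant term \<open>- q\<close> has to be the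
    product of the roots.\<close>
  have "z\<^sup>2 - of_int a * z - of_int (- k) = (z - \<alpha>) * (z - \<beta>)" for z
    by (simp add: k algebra_simps power2_eq_square flip: a)
  then show ?thesis
    by blast
qed

end
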